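(* Every weak double cycle has at most one unit-free skew-symmetry.
   Context: A digraph has a finite vertex set and arcs $(a,b)$ with $a\ne b$, no parallel arcs. For $m\ge3$ a double $m$-cycle is a digraph isomorphic to the one with vertices $1,\dots,m$ and arcs $(i,i+1),(i+1,i)$ (indices mod $m$). Splitting a vertex $x$ replaces $x$ by new vertices $u,w$ with an arc $(u,w)$, arcs into $x$ now into $u$, arcs out of $x$ now out of $w$. Splitting an arc $(x,y)$ replaces it by $(x,w),(w,y)$ for a new vertex $w$. A weak double cycle (WDC) is a digraph obtained from some double $m$-cycle ($m\ge3$) by finitely many (possibly zero) vertex- and arc-splittings. A skew-symmetry of a digraph $G$ is a bijection $\sigma:V(G)\to V(G)$ with $\sigma(\sigma(v))=v$ and $\sigma(v)\ne v$ for all $v$, such that $(a,b)\in E(G)$ implies $(\sigma(b),\sigma(a))\in E(G)$. It is unit-free if $(v,\sigma(v))\notin E(G)$ for all $v\in V(G)$. *)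

theory Defs
  imports "Graph_Theory.Pair_Digraph" "Graph_Theory.Digraph_Isomorphism"
begin

(* Digraphs are the library's 'a pair_pre_digraph: arcs are ordered pairs, so there are no
   parallel arcs.  The locale pair_digraph adds finiteness and a \<noteq> b for every arc (a,b). *)

text \<open>The successor of \<open>i\<close> modulo \<open>m\<close>, with representatives \<open>1, \<dots>, m\<close>, is \<open>i mod m + 1\<close>.\<close>

definition standard_double_cycle :: "nat \<Rightarrow> nat pair_pre_digraph" where
  "standard_double_cycle m =
     \<lparr> pverts = {1..m},
       parcs = {(i, i mod m + 1) | i. i \<in> {1..m}} \<union> {(i mod m + 1, i) | i. i \<in> {1..m}} \<rparr>"

definition is_double_cycle :: "nat \<Rightarrow> 'a pair_pre_digraph \<Rightarrow> bool" where
  "is_double_cycle m G \<longleftrightarrow>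
     m \<ge> 3 \<and> digraph_iso (with_proj (standard_double_cycle m)) (with_proj G)"

definition split_vertex :: "'a pair_pre_digraph \<Rightarrow> 'a \<Rightarrow> 'a \<Rightarrow> 'a \<Rightarrow> 'a pair_pre_digraph" where
  "split_vertex G x u w =
     \<lparr> pverts = (pverts G - {x}) \<union> {u, w},
       parcs = {(if a = x then w else a, if b = x then u else b) | a b. (a, b) \<in> parcs G}
               \<union> {(u, w)} \<rparr>"

definition split_arc :: "'a pair_pre_digraph \<Rightarrow> 'a \<Rightarrow> 'a \<Rightarrow> 'a \<Rightarrow> 'a pair_pre_digraph" where
  "split_arc G x y w =
     \<lparr> pverts = insert w (pverts G),
       parcs = (parcs G - {(x, y)}) \<union> {(x, w), (w, y)} \<rparr>"

text \<open>
  In a vertex-splitting the two new vertices only have to avoid the vertices other than \<open>x\<close>.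
  Since \<open>x\<close> is removed, its name may be reused; this way no weak double cycle
  is lost when the vertex type is finite and has no spare names.
\<close>

inductive weak_double_cycle :: "'a pair_pre_digraph \<Rightarrow> bool" where
  double_cycle: "is_double_cycle m G \<Longrightarrow> weak_double_cycle G"
| split_vertex: "\<lbrakk> weak_double_cycle G; x \<in> pverts G; u \<noteq> w;
      u \<notin> pverts G - {x}; w \<notin> pverts G - {x} \<rbrakk>
    \<Longrightarrow> weak_double_cycle (split_vertex G x u w)"
| split_arc: "\<lbrakk> weak_double_cycle G; (x, y) \<in> parcs G; w \<notin> pverts G \<rbrakk>
    \<Longrightarrow> weak_double_cycle (split_arc G x y w)"

text \<open>Only the values of \<open>\<sigma>\<close> on the vertex set matter.\<close>

definition skew_symmetry :: "'a pair_pre_digraph \<Rightarrow> ('a \<Rightarrow> 'a) \<Rightarrow> bool" where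
  "skew_symmetry G \<sigma> \<longleftrightarrow>
     bij_betw \<sigma> (pverts G) (pverts G) \<and>
     (\<forall>v \<in> pverts G. \<sigma> (\<sigma> v) = v \<and> \<sigma> v \<noteq> v) \<and>
     (\<forall>a b. (a, b) \<in> parcs G \<longrightarrow> (\<sigma> b, \<sigma> a) \<in> parcs G)"

definition unit_free :: "'a pair_pre_digraph \<Rightarrow> ('a \<Rightarrow> 'a) \<Rightarrow> bool" where
  "unit_free G \<sigma> \<longleftrightarrow> (\<forall>v \<in> pverts G. (v, \<sigma> v) \<notin> parcs G)"

lemma pair_digraph_standard_double_cycle:
  assumes "m \<ge> 3"
  shows "pair_digraph (standard_double_cycle m)"
proof
  fix e assume e: "e \<in> parcs (standard_double_cycle m)"
  then obtain i where i: "i \<in> {1..m}" "e = (i, i mod m + 1) \<or> e = (i mod m + 1, i)"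
    by (auto simp: standard_double_cycle_def)
  have "i mod m < m" "i mod m + 1 \<noteq> i"
    using assms i(1) by (auto, cases "i = m", auto)
  then have "Suc (i mod m) \<le> m" "i mod m + 1 \<noteq> i" by simp_all
  then show "fst e \<in> pverts (standard_double_cycle m)" "snd e \<in> pverts (standard_double_cycle m)"
    "fst e \<noteq> snd e"
    using i by (auto simp: standard_double_cycle_def)
qed (auto simp: standard_double_cycle_def)

lemma weak_double_cycle_pair_digraph:
  assumes "weak_double_cycle G"
  shows "pair_digraph G"
  using assms
proof induction
  case (double_cycle m G)
  let ?C = "standard_double_cycle m"
  from double_cycle obtain h where m: "m \<ge> 3"
    and h: "pre_digraph.digraph_isomorphism (with_proj ?C) h"
    and G: "with_proj G = app_iso h (with_proj ?C)"
    by (auto simp: is_double_cycle_def digraph_iso_def)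
  interpret C: pair_digraph ?C by (rule pair_digraph_standard_double_cycle[OF m])
  interpret D: fin_digraph "with_proj G"
    unfolding G using h by (rule C.fin_digraphI_app_iso)
  have "fst e \<noteq> snd e" if "e \<in> parcs G" for e
  proof -
    have eqs: "parcs G = iso_arcs h ` parcs ?C" "iso_tail h = fst" "iso_head h = snd"
      using arg_cong[OF G, of arcs] arg_cong[OF G, of tail] arg_cong[OF G, of head] by simp_all
    then obtain a where a: "a \<in> parcs ?C" "e = iso_arcs h a" using \<open>e \<in> parcs G\<close> by auto
    have "inj_on (iso_verts h) (pverts ?C)"
      "iso_verts h (fst a) = fst e" "iso_verts h (snd a) = snd e"
      using h a eqs by (auto simp: pre_digraph.digraph_isomorphism_def)
    then show ?thesis
      using C.pair_no_loops[OF a(1)] C.arc_fst_in_verts[OF a(1)] C.arc_snd_in_verts[OF a(1)]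
      by (metis inj_onD)
  qed
  then show ?case
    using D.tail_in_verts D.head_in_verts D.finite_verts D.finite_arcs
    by unfold_locales auto
next
  case (split_vertex G x u w)
  interpret pair_digraph G by fact
  let ?H = "split_vertex G x u w"
  have arc: "fst e \<in> pverts ?H \<and> snd e \<in> pverts ?H \<and> fst e \<noteq> snd e" if "e \<in> parcs ?H" for e
  proof -
    from that consider "e = (u, w)"
      | a b where "(a, b) \<in> parcs G" "e = (if a = x then w else a, if b = x then u else b)"
      unfolding split_vertex_def by fastforce
    then show ?thesis
    proof cases
      case 1
      then show ?thesis using split_vertex.hyps by (simp add: split_vertex_def)
    next
      case (2 a b)
      have "a \<in> pverts G" "b \<in> pverts G" "a \<noteq> b"
        using in_arcsD1[OF 2(1)] in_arcsD2[OF 2(1)] pair_no_loops[OF 2(1)] by simp_all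
      then show ?thesis using split_vertex.hyps 2(2) by (auto simp: split_vertex_def)
    qed
  qed
  have fin: "finite (pverts ?H)" by (simp add: split_vertex_def pair_finite_verts)
  have "parcs ?H \<subseteq> pverts ?H \<times> pverts ?H"
  proof
    fix e assume "e \<in> parcs ?H"
    then show "e \<in> pverts ?H \<times> pverts ?H" using arc[of e] by (simp add: mem_Times_iff)
  qed
  then have "finite (parcs ?H)" using fin by (meson finite_SigmaI finite_subset)
  with fin arc show ?case by unfold_locales blast+
next
  case (split_arc G x y w)
  interpret pair_digraph G by fact
  have "a \<noteq> b" if "(a, b) \<in> parcs G" for a b using pair_no_loops[OF that] by simp
  then show ?case using split_arc
    by unfold_locales
      (auto simp: split_arc_def pair_finite_verts pair_finite_arcs dest: wellformed')
qed

end

theory Submission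
  imports Defs
begin

text \<open>
  A weak double cycle \<open>G\<close> arises from a double cycle \<open>H\<close> by replacing every vertex \<open>i\<close> by a
  directed path \<open>P i\<close> (all arcs into \<open>i\<close> enter at its head, all arcs out of \<open>i\<close> leave at its last
  vertex) and every arc by a directed path. The heads of the \<open>P i\<close> are exactly the vertices of
  indegree at least 2 and the last vertices those of outdegree at least 2, and a skew-symmetry
  exchanges these two sets. All other vertices have a unique successor, so a skew-symmetry \<open>\<sigma>\<close> maps
  each path onto the reverse of another one and thus induces a skew-symmetry of \<open>H\<close> which in turn
  determines \<open>\<sigma>\<close>. A path that is mapped onto its own reverse has a fixed vertex or a unit arc in its
  middle; hence the induced skew-symmetry is unit-free if \<open>\<sigma>\<close> is. Finally, a unit-free
  skew-symmetry of the double \<open>m\<close>-cycle cannot be a reflection, so it is the rotation by \<open>m / 2\<close>.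
\<close>

section \<open>Walks\<close>

fun steps :: "'a list \<Rightarrow> ('a \<times> 'a) set" where
  "steps [] = {}"
| "steps [x] = {}"
| "steps (x # y # zs) = insert (x, y) (steps (y # zs))"

lemma steps_Cons: "zs \<noteq> [] \<Longrightarrow> steps (x # zs) = insert (x, hd zs) (steps zs)"
  by (cases zs) auto

lemma steps_snoc: "zs \<noteq> [] \<Longrightarrow> steps (zs @ [x]) = insert (last zs, x) (steps zs)"
  by (induction zs rule: steps.induct) auto

lemma steps_rev: "steps (rev xs) = (steps xs)\<inverse>"
proof (induction xs)
  case (Cons x xs)
  then show ?case by (cases "xs = []") (auto simp: steps_snoc steps_Cons last_rev)
qed auto

lemma steps_map: "steps (map f xs) = map_prod f f ` steps xs"
  by (induction xs rule: steps.induct) auto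

lemma steps_butlast_tl: "(a, b) \<in> steps xs \<Longrightarrow> a \<in> set (butlast xs) \<and> b \<in> set (tl xs)"
  by (induction xs rule: steps.induct) auto

lemma steps_set: "(a, b) \<in> steps xs \<Longrightarrow> a \<in> set xs \<and> b \<in> set xs"
  by (induction xs rule: steps.induct) auto

lemma steps_functional:
  "\<lbrakk>distinct xs; (a, b) \<in> steps xs; (a, c) \<in> steps xs\<rbrakk> \<Longrightarrow> b = c"
  by (induction xs rule: steps.induct) (auto dest: steps_set)

lemma steps_hd: "\<lbrakk>distinct (x # zs); (x, b) \<in> steps (x # zs)\<rbrakk> \<Longrightarrow> b = hd zs"
  by (cases zs) (auto dest: steps_set)

lemma last_not_steps: "\<lbrakk>distinct xs; (last xs, b) \<in> steps xs\<rbrakk> \<Longrightarrow> False"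
  by (induction xs rule: steps.induct) (auto split: if_splits)

lemma nth_steps: "Suc k < length xs \<Longrightarrow> (xs ! k, xs ! Suc k) \<in> steps xs"
proof (induction xs arbitrary: k rule: steps.induct)
  case (3 x y zs)
  then show ?case by (cases k) auto
qed auto

section \<open>Branch vertices and walks between them\<close>

definition out_branch :: "'a pair_pre_digraph \<Rightarrow> 'a set" where
  "out_branch G = {v. \<exists>a b. a \<noteq> b \<and> (v, a) \<in> parcs G \<and> (v, b) \<in> parcs G}"

definition in_branch :: "'a pair_pre_digraph \<Rightarrow> 'a set" where
  "in_branch G = {v. \<exists>a b. a \<noteq> b \<and> (a, v) \<in> parcs G \<and> (b, v) \<in> parcs G}"

text \<open>Outside \<open>out_branch G\<close> a vertex has at most one successor, so two walks
  with the same first vertex run in parallel; both stop at their first vertex in \<open>X\<close>,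
  hence at the same place.\<close>

lemma walk_unique:
  assumes "xs \<noteq> []" "ys \<noteq> []" "hd xs = hd ys" "steps xs \<subseteq> parcs G" "steps ys \<subseteq> parcs G"
    and "set (butlast xs) \<inter> (out_branch G \<union> X) = {}"
    and "set (butlast ys) \<inter> (out_branch G \<union> X) = {}"
    and "last xs \<in> X" "last ys \<in> X"
  shows "xs = ys"
  using assms
proof (induction xs arbitrary: ys)
  case (Cons x xs)
  then obtain zs where ys: "ys = x # zs" by (cases ys) auto
  show ?case
  proof (cases "xs = [] \<or> zs = []")
    case True
    then show ?thesis using Cons.prems ys by (auto split: if_splits)
  next
    case False
    then have "x \<notin> out_branch G" "(x, hd xs) \<in> parcs G" "(x, hd zs) \<in> parcs G"
      using Cons.prems ys by (auto simp: steps_Cons)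
    then have "hd xs = hd zs" unfolding out_branch_def by blast
    then have "xs = zs"
      using False Cons.prems ys by (intro Cons.IH) (auto simp: steps_Cons split: if_splits)
    then show ?thesis using ys by simp
  qed
qed simp

text \<open>Reversal pairs position \<open>k\<close> with \<open>?n - Suc k\<close>. For even length
  \<sigma> exchanges the two middle vertices, which are joined by an arc; for odd length it fixes
  the middle vertex.\<close>

lemma no_self_reverse_walk:
  assumes "skew_symmetry G \<sigma>" "unit_free G \<sigma>"
    and "xs \<noteq> []" "set xs \<subseteq> pverts G" "steps xs \<subseteq> parcs G"
  shows "rev (map \<sigma> xs) \<noteq> xs"
proof
  assume eq: "rev (map \<sigma> xs) = xs"
  let ?n = "length xs"
  have n: "?n > 0" using assms by simp
  have nth: "xs ! k = \<sigma> (xs ! (?n - Suc k))" if "k < ?n" for k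
  proof -
    have "rev (map \<sigma> xs) ! k = \<sigma> (xs ! (?n - Suc k))"
      using that by (simp add: rev_nth)
    then show ?thesis using eq by simp
  qed
  show False
  proof (cases "even ?n")
    case True
    define k where "k = ?n div 2"
    have k: "k > 0" "k < ?n" "?n - Suc k = k - 1" using True n unfolding k_def by presburger+
    then have "(xs ! (k - 1), xs ! k) \<in> steps xs" using nth_steps[of "k - 1" xs] by simp
    moreover have "xs ! k = \<sigma> (xs ! (k - 1))" using nth[of k] k by simp
    moreover have "xs ! (k - 1) \<in> pverts G" using assms(4) k by (auto simp: subset_iff)
    ultimately show False using assms(2,5) by (auto simp: unit_free_def)
  next
    case False
    define k where "k = ?n div 2"
    have k: "k < ?n" "?n - Suc k = k" using False n unfolding k_def by presburger+
    then have "xs ! k = \<sigma> (xs ! k)" using nth[of k] by simp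
    moreover have "xs ! k \<in> pverts G" using assms(4) k by (auto simp: subset_iff)
    ultimately show False using assms(1) by (auto simp: skew_symmetry_def)
  qed
qed

section \<open>Path expansions of digraphs\<close>

text \<open>\<open>P i\<close> is the path that replaces the vertex \<open>i\<close>, and
  \<open>Q e\<close> lists the inner vertices of the path that replaces the arc \<open>e\<close>. An
  empty \<open>Q e\<close> stands for an arc that has not been subdivided. All these lists are
  pairwise disjoint.\<close>

locale path_expansion =
  fixes H :: "'b pair_pre_digraph" and P :: "'b \<Rightarrow> 'a list" and Q :: "'b \<times> 'b \<Rightarrow> 'a list"
    and G :: "'a pair_pre_digraph"
  assumes arc_verts: "(i, j) \<in> parcs H \<Longrightarrow> i \<in> pverts H \<and> j \<in> pverts H \<and> i \<noteq> j"
    and P_nonempty: "i \<in> pverts H \<Longrightarrow> P i \<noteq> []"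
    and distinct_P: "i \<in> pverts H \<Longrightarrow> distinct (P i)"
    and distinct_Q: "e \<in> parcs H \<Longrightarrow> distinct (Q e)"
    and PP: "\<lbrakk>i \<in> pverts H; j \<in> pverts H; x \<in> set (P i); x \<in> set (P j)\<rbrakk> \<Longrightarrow> i = j"
    and PQ: "\<lbrakk>i \<in> pverts H; e \<in> parcs H; x \<in> set (P i); x \<in> set (Q e)\<rbrakk> \<Longrightarrow> False"
    and QQ: "\<lbrakk>d \<in> parcs H; e \<in> parcs H; x \<in> set (Q d); x \<in> set (Q e)\<rbrakk> \<Longrightarrow> d = e"
    and verts: "pverts G = (\<Union>i\<in>pverts H. set (P i)) \<union> (\<Union>e\<in>parcs H. set (Q e))"
    and arcs: "parcs G = (\<Union>i\<in>pverts H. steps (P i)) \<union>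
      (\<Union>(i, j)\<in>parcs H. steps (last (P i) # Q (i, j) @ [hd (P j)]))"
begin

text \<open>The path replacing an arc, including the two end vertices that it shares with vertex
  paths: \<open>Q\<close> accounts for the vertices of \<open>G\<close>, \<open>W\<close> for the
  arcs.\<close>

definition W :: "'b \<times> 'b \<Rightarrow> 'a list" where
  "W e = last (P (fst e)) # Q e @ [hd (P (snd e))]"

lemma arcs_W: "parcs G = (\<Union>i\<in>pverts H. steps (P i)) \<union> (\<Union>e\<in>parcs H. steps (W e))"
  unfolding arcs W_def by auto

lemma hd_P [simp]: "i \<in> pverts H \<Longrightarrow> hd (P i) \<in> set (P i)"
  and last_P [simp]: "i \<in> pverts H \<Longrightarrow> last (P i) \<in> set (P i)"
  using P_nonempty by auto

lemma hd_P_eq: "\<lbrakk>i \<in> pverts H; j \<in> pverts H; hd (P i) = hd (P j)\<rbrakk> \<Longrightarrow> i = j"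
  and last_P_eq: "\<lbrakk>i \<in> pverts H; j \<in> pverts H; last (P i) = last (P j)\<rbrakk> \<Longrightarrow> i = j"
  by (metis PP hd_P last_P)+

lemma distinct_W:
  assumes "e \<in> parcs H"
  shows "distinct (W e)"
proof -
  obtain i j where e: "e = (i, j)" by (cases e)
  have ij: "i \<in> pverts H" "j \<in> pverts H" "i \<noteq> j" using arc_verts assms e by auto
  have "last (P i) \<noteq> hd (P j)" using ij PP hd_P last_P by metis
  moreover have "last (P i) \<notin> set (Q e)" "hd (P j) \<notin> set (Q e)"
    using ij PQ assms hd_P last_P by metis+
  ultimately show ?thesis using distinct_Q assms by (auto simp: W_def e)
qed

lemma steps_W_cases:
  assumes "(i, j) \<in> parcs H" "(a, b) \<in> steps (W (i, j))"
  obtains (start) "a = last (P i)" "b = hd (Q (i, j) @ [hd (P j)])"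
  | (inner) "a \<in> set (Q (i, j))"
proof -
  from steps_butlast_tl[OF assms(2)] have "a = last (P i) \<or> a \<in> set (Q (i, j))"
    by (auto simp: W_def butlast_append)
  then show thesis
  proof
    assume a: "a = last (P i)"
    then have "b = hd (Q (i, j) @ [hd (P j)])"
      using steps_hd distinct_W[OF assms(1)] assms(2) by (metis W_def fst_conv snd_conv)
    then show thesis using start a by blast
  qed (use inner in blast)
qed

text \<open>Arcs are sorted by their tail. By disjointness the three kinds of tail exclude each
  other, so two arcs with the same tail fall into the same case.\<close>

lemma arc_cases:
  assumes "(a, b) \<in> parcs G"
  obtains (vertex) i where "i \<in> pverts H" "(a, b) \<in> steps (P i)" "a \<in> set (P i)" "a \<noteq> last (P i)"
  | (start) i j where "(i, j) \<in> parcs H" "a = last (P i)" "b = hd (Q (i, j) @ [hd (P j)])"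
      "(a, b) \<in> steps (W (i, j))"
  | (inner) e where "e \<in> parcs H" "(a, b) \<in> steps (W e)" "a \<in> set (Q e)"
proof -
  from assms consider i where "i \<in> pverts H" "(a, b) \<in> steps (P i)"
    | i j where "(i, j) \<in> parcs H" "(a, b) \<in> steps (W (i, j))"
    unfolding arcs_W by auto
  then show thesis
  proof cases
    case 1
    then show thesis using vertex distinct_P last_not_steps steps_set by metis
  next
    case 2
    from 2 show thesis by (cases rule: steps_W_cases) (use start inner 2 in blast)+
  qed
qed

lemma start_arc:
  assumes "(i, j) \<in> parcs H"
  shows "(last (P i), hd (Q (i, j) @ [hd (P j)])) \<in> parcs G"
  unfolding arcs_W W_def using assms by (force simp: steps_Cons)

text \<open>The second vertex of an arc path is either the first vertex of \<open>Q\<close> or, if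
  \<open>Q\<close> is empty, the head of the target path; disjointness makes it determine the
  target. Hence different arcs leaving \<open>i\<close> in \<open>H\<close> yield different
  out-neighbours of \<open>last (P i)\<close>.\<close>

lemma start_unique:
  assumes ij: "(i, j) \<in> parcs H" and kl: "(k, l) \<in> parcs H"
    and eq: "hd (Q (i, j) @ [hd (P j)]) = hd (Q (k, l) @ [hd (P l)])"
  shows "j = l"
proof -
  note V = arc_verts[OF ij] arc_verts[OF kl]
  consider "Q (i, j) = []" "Q (k, l) = []" | "Q (i, j) \<noteq> []" "Q (k, l) = []"
    | "Q (i, j) = []" "Q (k, l) \<noteq> []" | "Q (i, j) \<noteq> []" "Q (k, l) \<noteq> []" by blast
  then show ?thesis
  proof cases
    case 1 then show ?thesis using eq V hd_P_eq by simp
  next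
    case 2 then show ?thesis using eq V PQ[OF _ ij hd_P[of l]]
      by (metis append_Nil hd_append hd_in_set list.sel(1))
  next
    case 3 then show ?thesis using eq V PQ[OF _ kl hd_P[of j]]
      by (metis append_Nil hd_append hd_in_set list.sel(1))
  next
    case 4 then show ?thesis using eq QQ[OF ij kl] by (metis hd_append hd_in_set prod.inject)
  qed
qed

text \<open>Disjointness puts both arcs on the same path, and a path without repeated vertices gives
  each vertex at most one successor.\<close>

lemma arc_out_unique:
  assumes "(a, b) \<in> parcs G" "(a, c) \<in> parcs G" "a \<notin> (\<lambda>i. last (P i)) ` pverts H"
  shows "b = c"
  using assms(1)
proof (cases rule: arc_cases)
  case (vertex i)
  note b = this
  from assms(2) show ?thesis
  proof (cases rule: arc_cases)
    case (vertex k)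
    then show ?thesis using b PP steps_functional distinct_P by metis
  next
    case (start k l)
    then show ?thesis using assms(3) arc_verts by blast
  next
    case (inner e)
    then show ?thesis using b PQ by metis
  qed
next
  case (start i j)
  then show ?thesis using assms(3) arc_verts by blast
next
  case (inner e)
  note b = this
  from assms(2) show ?thesis
  proof (cases rule: arc_cases)
    case (vertex k)
    then show ?thesis using b PQ by metis
  next
    case (start k l)
    then show ?thesis using assms(3) arc_verts by blast
  next
    case (inner d)
    then show ?thesis using b QQ steps_functional distinct_W by metis
  qed
qed

lemma start_arcD:
  assumes "(last (P i), b) \<in> parcs G" "i \<in> pverts H"
  obtains j where "(i, j) \<in> parcs H" "b = hd (Q (i, j) @ [hd (P j)])"
  using assms(1)
proof (cases rule: arc_cases)
  case (vertex k)
  then show ?thesis using PP assms(2) last_P by metis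
next
  case (start k l)
  then show ?thesis using last_P_eq assms(2) arc_verts that by metis
next
  case (inner e)
  then show ?thesis using PQ assms(2) last_P by metis
qed

lemma out_branch_eq:
  assumes "out_branch H = pverts H"
  shows "out_branch G = (\<lambda>i. last (P i)) ` pverts H"
proof
  show "out_branch G \<subseteq> (\<lambda>i. last (P i)) ` pverts H"
    using arc_out_unique unfolding out_branch_def by blast
  show "(\<lambda>i. last (P i)) ` pverts H \<subseteq> out_branch G"
  proof clarify
    fix i assume "i \<in> pverts H"
    then obtain j k where "j \<noteq> k" "(i, j) \<in> parcs H" "(i, k) \<in> parcs H"
      using assms unfolding out_branch_def by blast
    then show "last (P i) \<in> out_branch G"
      using start_arc start_unique unfolding out_branch_def by blast
  qed
qed

end

section \<open>Reversal of all arcs\<close>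

definition reverse_digraph :: "'a pair_pre_digraph \<Rightarrow> 'a pair_pre_digraph" where
  "reverse_digraph G = \<lparr>pverts = pverts G, parcs = (parcs G)\<inverse>\<rparr>"

lemma out_branch_reverse: "out_branch (reverse_digraph G) = in_branch G"
  by (simp add: out_branch_def in_branch_def reverse_digraph_def)

context path_expansion
begin

text \<open>Reversing all arcs reverses each path, so facts about outgoing arcs transfer to incoming
  ones; \<open>in_branch_eq\<close> is obtained from \<open>out_branch_eq\<close> this way.\<close>

lemma path_expansion_reverse:
  "path_expansion (reverse_digraph H) (\<lambda>i. rev (P i)) (\<lambda>(i, j). rev (Q (j, i))) (reverse_digraph G)"
proof
  have eq: "last (rev (P j)) # rev (Q (i, j)) @ [hd (rev (P i))] = rev (W (i, j))"
    if "(i, j) \<in> parcs H" for i j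
    using arc_verts[OF that] P_nonempty by (simp add: W_def last_rev hd_rev)
  have "(\<Union>(i, j)\<in>parcs (reverse_digraph H). steps (last (rev (P i)) #
      (case (i, j) of (i, j) \<Rightarrow> rev (Q (j, i))) @ [hd (rev (P j))]))
    = (\<Union>(i, j)\<in>parcs H. steps (rev (W (i, j))))"
    unfolding reverse_digraph_def using eq by auto
  then show "parcs (reverse_digraph G) = (\<Union>i\<in>pverts (reverse_digraph H). steps (rev (P i))) \<union>
    (\<Union>(i, j)\<in>parcs (reverse_digraph H). steps (last (rev (P i)) #
      (case (i, j) of (i, j) \<Rightarrow> rev (Q (j, i))) @ [hd (rev (P j))]))"
    by (auto simp: reverse_digraph_def arcs_W steps_rev)
  show "pverts (reverse_digraph G) = (\<Union>i\<in>pverts (reverse_digraph H). set (rev (P i))) \<union>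
    (\<Union>e\<in>parcs (reverse_digraph H). set (case e of (i, j) \<Rightarrow> rev (Q (j, i))))"
    by (auto simp: reverse_digraph_def verts)
qed (auto simp: reverse_digraph_def P_nonempty distinct_P distinct_Q
      dest: arc_verts PP PQ QQ)

lemma in_branch_eq:
  assumes "in_branch H = pverts H"
  shows "in_branch G = (\<lambda>i. hd (P i)) ` pverts H"
proof -
  interpret R: path_expansion "reverse_digraph H" "\<lambda>i. rev (P i)" "\<lambda>(i, j). rev (Q (j, i))"
    "reverse_digraph G" by (rule path_expansion_reverse)
  have "pverts (reverse_digraph H) = pverts H" by (simp add: reverse_digraph_def)
  then show ?thesis
    using R.out_branch_eq assms P_nonempty by (simp add: out_branch_reverse last_rev)
qed

lemma set_W:
  assumes "e \<in> parcs H"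
  shows "set (W e) \<subseteq> pverts G"
proof -
  obtain i j where e: "e = (i, j)" by (cases e)
  have "i \<in> pverts H" "j \<in> pverts H" using arc_verts assms e by auto
  then have "last (P i) \<in> pverts G" "hd (P j) \<in> pverts G"
    using hd_P last_P unfolding verts by blast+
  then show ?thesis using assms by (auto simp: verts W_def e)
qed

text \<open>The start of an arc path is itself a branch vertex. Without it the walk avoids all
  branch vertices before its end, as \<open>walk_unique\<close> requires with
  \<open>X = in_branch G\<close>.\<close>

lemma tl_W_branch:
  assumes "out_branch H = pverts H" "in_branch H = pverts H" and e: "(i, j) \<in> parcs H"
  shows "set (butlast (tl (W (i, j)))) \<inter> (out_branch G \<union> in_branch G) = {}"
    and "last (tl (W (i, j))) \<in> in_branch G"
proof -
  show "set (butlast (tl (W (i, j)))) \<inter> (out_branch G \<union> in_branch G) = {}"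
    using PQ[OF _ e last_P] PQ[OF _ e hd_P]
    by (auto simp: W_def out_branch_eq in_branch_eq assms)
  show "last (tl (W (i, j))) \<in> in_branch G"
    using arc_verts[OF e] by (auto simp: W_def in_branch_eq assms)
qed

end

section \<open>The induced skew-symmetry\<close>

text \<open>Two arcs into \<open>v\<close> become two arcs out of \<open>\<sigma> v\<close>, with
  different heads because \<sigma> is injective on the vertices; the other direction is
  dual.\<close>

lemma skew_symmetry_branch:
  assumes "skew_symmetry G \<sigma>" "pair_digraph G"
  shows "v \<in> in_branch G \<Longrightarrow> \<sigma> v \<in> out_branch G" "v \<in> out_branch G \<Longrightarrow> \<sigma> v \<in> in_branch G"
proof -
  interpret pair_digraph G by fact
  have inj: "\<sigma> a \<noteq> \<sigma> b" if "a \<noteq> b" "a \<in> pverts G" "b \<in> pverts G" for a b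
    using assms(1) that unfolding skew_symmetry_def by metis
  have arc: "(\<sigma> b, \<sigma> a) \<in> parcs G" if "(a, b) \<in> parcs G" for a b
    using assms(1) that unfolding skew_symmetry_def by blast
  show "v \<in> in_branch G \<Longrightarrow> \<sigma> v \<in> out_branch G"
    unfolding in_branch_def out_branch_def using inj arc in_arcsD1 by blast
  show "v \<in> out_branch G \<Longrightarrow> \<sigma> v \<in> in_branch G"
    unfolding in_branch_def out_branch_def using inj arc in_arcsD2 by blast
qed

text \<open>The assumptions \<open>out_H\<close> and \<open>in_H\<close> make the ends of the vertex
  paths recognisable as the branch vertices of \<open>G\<close>, so that \<sigma> has to respect
  them.\<close>

locale skew_path_expansion = path_expansion H P Q G + pair_digraph G
  for H :: "'b pair_pre_digraph" and P :: "'b \<Rightarrow> 'a list" and Q :: "'b \<times> 'b \<Rightarrow> 'a list"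
    and G :: "'a pair_pre_digraph" +
  fixes \<sigma> :: "'a \<Rightarrow> 'a"
  assumes out_H: "out_branch H = pverts H" and in_H: "in_branch H = pverts H"
    and skew: "skew_symmetry G \<sigma>" and unit_free: "unit_free G \<sigma>"
begin

lemma out_G: "out_branch G = (\<lambda>i. last (P i)) ` pverts H"
  and in_G: "in_branch G = (\<lambda>i. hd (P i)) ` pverts H"
  using out_branch_eq in_branch_eq out_H in_H by auto

lemma steps_rev_map:
  assumes "steps xs \<subseteq> parcs G"
  shows "steps (rev (map \<sigma> xs)) \<subseteq> parcs G"
  using assms skew by (auto simp: steps_rev steps_map skew_symmetry_def)

text \<open>Converses of \<open>skew_symmetry_branch\<close>, since \<sigma> is an
  involution.\<close>

lemma \<sigma>_in: "v \<in> pverts G \<Longrightarrow> \<sigma> v \<in> out_branch G \<Longrightarrow> v \<in> in_branch G"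
  and \<sigma>_out: "v \<in> pverts G \<Longrightarrow> \<sigma> v \<in> in_branch G \<Longrightarrow> v \<in> out_branch G"
  using skew_symmetry_branch[OF skew pair_digraph_axioms] skew
  unfolding skew_symmetry_def by metis+

lemma steps_P: "i \<in> pverts H \<Longrightarrow> steps (P i) \<subseteq> parcs G"
  and steps_W: "e \<in> parcs H \<Longrightarrow> steps (W e) \<subseteq> parcs G"
  unfolding arcs_W by auto

lemma set_P: "i \<in> pverts H \<Longrightarrow> set (P i) \<subseteq> pverts G"
  unfolding verts by auto

lemma butlast_P:
  assumes "i \<in> pverts H"
  shows "set (butlast (P i)) \<inter> out_branch G = {}"
proof -
  have "last (P k) \<notin> set (butlast (P i))" if "k \<in> pverts H" for k
  proof
    assume k: "last (P k) \<in> set (butlast (P i))"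
    then have "k = i" using PP that assms last_P in_set_butlastD by metis
    then show False
      using k distinct_P[OF assms] P_nonempty[OF assms]
      by (metis append_butlast_last_id distinct_append disjoint_iff list.set_intros(1))
  qed
  then show ?thesis by (auto simp: out_G)
qed

lemma tl_P:
  assumes "i \<in> pverts H"
  shows "set (tl (P i)) \<inter> in_branch G = {}"
proof -
  have "hd (P k) \<notin> set (tl (P i))" if "k \<in> pverts H" for k
  proof
    assume k: "hd (P k) \<in> set (tl (P i))"
    then have "k = i" using PP that assms hd_P P_nonempty list.set_sel(2) by metis
    then show False
      using k distinct_P[OF assms] P_nonempty[OF assms] by (cases "P i") auto
  qed
  then show ?thesis by (auto simp: in_G)
qed

text \<open>The reversed image starts at \<open>\<sigma> (last (P i))\<close>, which lies in
  \<open>in_branch G\<close> and so is the head of some \<open>P k\<close>. Both walks end at their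
  first vertex in \<open>out_branch G\<close>, so they coincide.\<close>

lemma P_image:
  assumes i: "i \<in> pverts H"
  shows "\<exists>k\<in>pverts H. rev (map \<sigma> (P i)) = P k"
proof -
  have "last (P i) \<in> out_branch G" "hd (P i) \<in> in_branch G" using i out_G in_G by auto
  then have ends: "\<sigma> (last (P i)) \<in> in_branch G" "\<sigma> (hd (P i)) \<in> out_branch G"
    using skew_symmetry_branch[OF skew pair_digraph_axioms] by auto
  then obtain k where k: "k \<in> pverts H" "\<sigma> (last (P i)) = hd (P k)" using in_G by auto
  have "rev (map \<sigma> (P i)) = P k"
  proof (rule walk_unique[where G = G and X = "out_branch G"])
    have "butlast (rev (map \<sigma> (P i))) = rev (map \<sigma> (tl (P i)))"
      by (simp add: butlast_rev map_tl)
    \<comment> \<open>An image in \<open>out_branch G\<close> before the end would come from a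
      vertex of \<open>in_branch G\<close> after the head of \<open>P i\<close>, against
      \<open>tl_P\<close>.\<close>
    moreover have "v \<in> in_branch G" if "v \<in> set (tl (P i))" "\<sigma> v \<in> out_branch G" for v
      using that \<sigma>_in set_P[OF i] P_nonempty[OF i] by (meson list.set_sel(2) subsetD)
    ultimately show "set (butlast (rev (map \<sigma> (P i)))) \<inter> (out_branch G \<union> out_branch G) = {}"
      using tl_P[OF i] by auto
  qed (use i k ends P_nonempty steps_rev_map steps_P butlast_P out_G in
      \<open>auto simp: hd_rev last_rev last_map hd_map\<close>)
  then show ?thesis using k by blast
qed

text \<open>For a vertex \<open>i\<close> of \<open>H\<close> exactly one \<open>k\<close>
  qualifies: it exists by \<open>P_image\<close> and is determined by the head of
  \<open>P k\<close>.\<close>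

definition induced :: "'b \<Rightarrow> 'b" where
  "induced i = (SOME k. k \<in> pverts H \<and> rev (map \<sigma> (P i)) = P k)"

lemma induced:
  assumes "i \<in> pverts H"
  shows "induced i \<in> pverts H" "rev (map \<sigma> (P i)) = P (induced i)"
  unfolding induced_def using P_image[OF assms]
    someI_ex[of "\<lambda>k. k \<in> pverts H \<and> rev (map \<sigma> (P i)) = P k"]
  by auto

lemma hd_induced: "i \<in> pverts H \<Longrightarrow> hd (P (induced i)) = \<sigma> (last (P i))"
  and last_induced: "i \<in> pverts H \<Longrightarrow> last (P (induced i)) = \<sigma> (hd (P i))"
  by (simp_all add: induced(2)[symmetric] hd_rev last_rev last_map hd_map P_nonempty)

text \<open>The reversed image starts at the branch vertex \<open>last (P (induced j))\<close>,
  where the successor is not unique. Its second vertex selects an arc \<open>(induced j, l)\<close>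
  of \<open>H\<close>; from there on the walk is determined up to its end, and the end identifies
  \<open>l\<close> with \<open>induced i\<close>.\<close>

lemma W_image:
  assumes e: "(i, j) \<in> parcs H"
  shows "(induced j, induced i) \<in> parcs H"
    and "rev (map \<sigma> (W (i, j))) = W (induced j, induced i)"
proof -
  note V = arc_verts[OF e]
  \<comment> \<open>The reversed image without its first vertex
    \<open>\<sigma> (hd (P j))\<close>.\<close>
  define ys where "ys = rev (map \<sigma> (last (P i) # Q (i, j)))"
  have ys: "rev (map \<sigma> (W (i, j))) = last (P (induced j)) # ys"
    using V by (simp add: W_def ys_def last_induced)
  have [simp]: "ys \<noteq> []" by (simp add: ys_def)
  have sub: "steps (last (P (induced j)) # ys) \<subseteq> parcs G"
    using steps_rev_map[OF steps_W[OF e]] ys by simp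
  then have "(last (P (induced j)), hd ys) \<in> parcs G" by (simp add: steps_Cons)
  then obtain l where l: "(induced j, l) \<in> parcs H" "hd ys = hd (Q (induced j, l) @ [hd (P l)])"
    using start_arcD induced(1) V by metis
  have last: "last ys = hd (P (induced i))" using V by (simp add: ys_def hd_induced)
  have tlW: "tl (W (induced j, l)) = Q (induced j, l) @ [hd (P l)]" by (simp add: W_def)
  have "ys = tl (W (induced j, l))"
  proof (rule walk_unique[where G = G and X = "in_branch G"])
    have "v \<notin> out_branch G \<union> in_branch G \<and> v \<in> pverts G" if "v \<in> set (Q (i, j))" for v
      using that tl_W_branch(1)[OF out_H in_H e] e by (auto simp: W_def verts)
    then have "\<sigma> v \<notin> out_branch G \<union> in_branch G" if "v \<in> set (Q (i, j))" for v
      using that \<sigma>_in \<sigma>_out by blast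
    then show "set (butlast ys) \<inter> (out_branch G \<union> in_branch G) = {}"
      by (auto simp: ys_def)
    show "set (butlast (tl (W (induced j, l)))) \<inter> (out_branch G \<union> in_branch G) = {}"
      "last (tl (W (induced j, l))) \<in> in_branch G"
      using tl_W_branch[OF out_H in_H l(1)] by blast+
    show "steps ys \<subseteq> parcs G" using sub by (simp add: steps_Cons)
    show "steps (tl (W (induced j, l))) \<subseteq> parcs G"
      using steps_W[OF l(1)] by (simp add: W_def steps_Cons)
    show "last ys \<in> in_branch G" using last in_G V induced(1) by auto
  qed (use l tlW in auto)
  then have W: "rev (map \<sigma> (W (i, j))) = W (induced j, l)" using ys by (simp add: W_def)
  have "hd (P l) = hd (P (induced i))"
    using last \<open>ys = tl (W (induced j, l))\<close> tlW by simp
  then have "l = induced i" using hd_P_eq arc_verts[OF l(1)] induced(1) V by blast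
  then show "(induced j, induced i) \<in> parcs H" "rev (map \<sigma> (W (i, j))) = W (induced j, induced i)"
    using l W by auto
qed

text \<open>Two applications of \<open>induced\<close> apply \<sigma> twice to the head of
  \<open>P i\<close>, and the head determines \<open>i\<close>.\<close>

lemma induced_induced:
  assumes "i \<in> pverts H"
  shows "induced (induced i) = i"
proof -
  have "hd (P (induced (induced i))) = \<sigma> (\<sigma> (hd (P i)))"
    using assms induced(1) by (simp add: hd_induced last_induced)
  also have "\<dots> = hd (P i)"
    using skew set_P[OF assms] hd_P[OF assms] unfolding skew_symmetry_def by blast
  finally show ?thesis using hd_P_eq assms induced(1) by blast
qed

lemma skew_symmetry_induced: "skew_symmetry H induced"
  unfolding skew_symmetry_def
proof (intro conjI ballI allI impI)
  show "bij_betw induced (pverts H) (pverts H)"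
    by (rule bij_betw_byWitness[where f' = induced]) (auto simp: induced_induced induced(1))
  \<comment> \<open>A fixed vertex \<open>i\<close> would make \<open>P i\<close> its own reversed
    image.\<close>
  show "induced i \<noteq> i" if "i \<in> pverts H" for i
    using no_self_reverse_walk[OF skew unit_free P_nonempty set_P steps_P] that induced(2) by metis
qed (use W_image(1) induced_induced in auto)

text \<open>Since \<open>induced\<close> is an involution, an arc \<open>(i, induced i)\<close> is
  sent to itself, so its path would be its own reversed image.\<close>

lemma unit_free_induced: "unit_free H induced"
  unfolding unit_free_def
proof (intro ballI notI)
  fix i assume i: "i \<in> pverts H" and e: "(i, induced i) \<in> parcs H"
  then have "rev (map \<sigma> (W (i, induced i))) = W (i, induced i)"
    using W_image(2)[OF e] induced_induced by simp
  moreover have "W (i, induced i) \<noteq> []" by (simp add: W_def)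
  ultimately show False
    using no_self_reverse_walk[OF skew unit_free _ set_W[OF e] steps_W[OF e]] by blast
qed

end

text \<open>Uniqueness on \<open>H\<close> makes the two induced maps equal. Then \<sigma> and
  \<tau> send each path to the same list, hence agree on each of its entries.\<close>

lemma path_expansion_unique:
  assumes "path_expansion H P Q G" "pair_digraph G"
    and "out_branch H = pverts H" "in_branch H = pverts H"
    and unique: "\<And>f g. \<lbrakk>skew_symmetry H f; unit_free H f; skew_symmetry H g; unit_free H g\<rbrakk>
      \<Longrightarrow> \<forall>i\<in>pverts H. f i = g i"
    and "skew_symmetry G \<sigma>" "unit_free G \<sigma>" "skew_symmetry G \<tau>" "unit_free G \<tau>"
  shows "\<forall>v\<in>pverts G. \<sigma> v = \<tau> v"
proof
  interpret path_expansion H P Q G by fact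
  interpret s: skew_path_expansion H P Q G \<sigma>
    using assms by (simp add: skew_path_expansion_def skew_path_expansion_axioms_def)
  interpret t: skew_path_expansion H P Q G \<tau>
    using assms by (simp add: skew_path_expansion_def skew_path_expansion_axioms_def)
  have eq: "s.induced i = t.induced i" if "i \<in> pverts H" for i
    using unique[OF s.skew_symmetry_induced s.unit_free_induced
        t.skew_symmetry_induced t.unit_free_induced] that by blast
  fix v assume "v \<in> pverts G"
  then consider i where "i \<in> pverts H" "v \<in> set (P i)"
    | i j where "(i, j) \<in> parcs H" "v \<in> set (Q (i, j))" unfolding verts by auto
  then show "\<sigma> v = \<tau> v"
  proof cases
    case 1
    then have "rev (map \<sigma> (P i)) = rev (map \<tau> (P i))"
      using s.induced(2) t.induced(2) eq by simp
    then show ?thesis using 1 by simp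
  next
    case 2
    then have "rev (map \<sigma> (W (i, j))) = rev (map \<tau> (W (i, j)))"
      using s.W_image(2) t.W_image(2) eq arc_verts by simp
    then show ?thesis using 2 by (simp add: W_def)
  qed
qed

section \<open>Vertex- and arc-splittings of path expansions\<close>

definition split_in_list :: "'a \<Rightarrow> 'a \<Rightarrow> 'a \<Rightarrow> 'a list \<Rightarrow> 'a list" where
  "split_in_list x u w xs = concat (map (\<lambda>y. if y = x then [u, w] else [y]) xs)"

lemma split_in_list_simps [simp]:
  "split_in_list x u w [] = []"
  "split_in_list x u w (y # ys) = (if y = x then [u, w] else [y]) @ split_in_list x u w ys"
  by (simp_all add: split_in_list_def)

lemma split_in_list_eq_Nil [simp]: "split_in_list x u w xs = [] \<longleftrightarrow> xs = []"
  by (cases xs) auto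

lemma hd_split_in_list: "xs \<noteq> [] \<Longrightarrow> hd (split_in_list x u w xs) = (if hd xs = x then u else hd xs)"
  by (cases xs) auto

lemma last_split_in_list:
  "xs \<noteq> [] \<Longrightarrow> last (split_in_list x u w xs) = (if last xs = x then w else last xs)"
  by (induction xs) (auto split: if_splits)

lemma set_split_in_list:
  "set (split_in_list x u w xs) = set xs - {x} \<union> (if x \<in> set xs then {u, w} else {})"
  by (induction xs) auto

lemma distinct_split_in_list:
  "\<lbrakk>distinct xs; u \<noteq> w; u \<notin> set xs - {x}; w \<notin> set xs - {x}\<rbrakk> \<Longrightarrow> distinct (split_in_list x u w xs)"
  by (induction xs) (auto simp: set_split_in_list)

text \<open>The effect of a vertex-splitting on an old arc, written as a function so that the new
  arcs other than \<open>(u, w)\<close> form an image.\<close>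

definition split_ends :: "'a \<Rightarrow> 'a \<Rightarrow> 'a \<Rightarrow> 'a \<times> 'a \<Rightarrow> 'a \<times> 'a" where
  "split_ends x u w e = (if fst e = x then w else fst e, if snd e = x then u else snd e)"

lemma parcs_split_vertex:
  "parcs (split_vertex G x u w) = insert (u, w) (split_ends x u w ` parcs G)"
proof -
  have "{(if a = x then w else a, if b = x then u else b) | a b. (a, b) \<in> parcs G} =
    (\<lambda>(a, b). (if a = x then w else a, if b = x then u else b)) ` parcs G"
    by (rule set_eqI,
        simp only: image_iff mem_Collect_eq Bex_def split_paired_Ex prod.case) blast
  also have "\<dots> = split_ends x u w ` parcs G"
    by (rule image_cong) (simp_all add: split_ends_def split_beta)
  finally show ?thesis by (simp add: split_vertex_def)
qed

lemma steps_split_in_list: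
  "steps (split_in_list x u w xs) =
    split_ends x u w ` steps xs \<union> (if x \<in> set xs then {(u, w)} else {})"
proof (induction xs rule: steps.induct)
  case (3 y z zs)
  have "steps (split_in_list x u w (y # z # zs)) = (if y = x then {(u, w)} else {}) \<union>
    insert (split_ends x u w (y, z)) (steps (split_in_list x u w (z # zs)))"
    by (auto simp: split_ends_def steps_Cons)
  then show ?case unfolding 3 by auto
qed auto

text \<open>This serves the arc paths: \<open>a\<close> is the last vertex of a vertex path and
  \<open>b\<close> the head of one. If either is \<open>x\<close>, it is only renamed to the half of
  \<open>x\<close> that the arc path touches.\<close>

lemma steps_split_in_list_ends:
  "steps ((if a = x then w else a) # split_in_list x u w xs @ [if b = x then u else b]) =
    split_ends x u w ` steps (a # xs @ [b]) \<union> (if x \<in> set xs then {(u, w)} else {})"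
proof (cases "xs = []")
  case False
  then show ?thesis
    by (auto simp: steps_Cons steps_snoc steps_split_in_list hd_split_in_list last_split_in_list
        split_ends_def)
qed (auto simp: split_ends_def)

text \<open>The vertex \<open>x\<close> lies in exactly one list, and replacing it there by
  \<open>u, w\<close> lengthens that path. If \<open>x\<close> is the head of a vertex path the new
  head is \<open>u\<close>, and if it is the last vertex the new last vertex is \<open>w\<close>, as
  the redirected arcs demand.\<close>

lemma path_expansion_split_vertex:
  assumes "path_expansion H P Q G" and x: "x \<in> pverts G"
    and u: "u \<noteq> w" "u \<notin> pverts G - {x}" "w \<notin> pverts G - {x}"
  shows "path_expansion H (split_in_list x u w \<circ> P) (split_in_list x u w \<circ> Q) (split_vertex G x u w)"
proof -
  interpret path_expansion H P Q G by fact
  have sub: "set (P i) \<subseteq> pverts G" if "i \<in> pverts H" for i using that by (auto simp: verts)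
  have subQ: "set (Q e) \<subseteq> pverts G" if "e \<in> parcs H" for e using that by (auto simp: verts)
  let ?s = "split_in_list x u w"
  \<comment> \<open>Contracts \<open>u\<close> and \<open>w\<close> back to \<open>x\<close>. As
    these names avoid all other old vertices, \<open>?p\<close> carries membership in a new list to
    membership in the old one, and disjointness is inherited.\<close>
  let ?p = "\<lambda>y. if y = u \<or> y = w then x else y"
  have mem: "?p y \<in> set ys" if "y \<in> set (?s ys)" "set ys \<subseteq> pverts G" for y ys
    using that u by (auto simp: set_split_in_list split: if_splits)
  show ?thesis
  proof
    show "pverts (split_vertex G x u w) =
      (\<Union>i\<in>pverts H. set ((?s \<circ> P) i)) \<union> (\<Union>e\<in>parcs H. set ((?s \<circ> Q) e))"
      using x by (auto simp: split_vertex_def verts set_split_in_list split: if_splits)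
    have "steps (last ((?s \<circ> P) i) # (?s \<circ> Q) (i, j) @ [hd ((?s \<circ> P) j)]) =
      split_ends x u w ` steps (W (i, j)) \<union> (if x \<in> set (Q (i, j)) then {(u, w)} else {})"
      if "(i, j) \<in> parcs H" for i j
      using arc_verts[OF that] P_nonempty
      by (simp add: hd_split_in_list last_split_in_list steps_split_in_list_ends W_def)
    then have "(\<Union>(i, j)\<in>parcs H. steps (last ((?s \<circ> P) i) # (?s \<circ> Q) (i, j) @ [hd ((?s \<circ> P) j)])) =
      (\<Union>e\<in>parcs H. split_ends x u w ` steps (W e) \<union> (if x \<in> set (Q e) then {(u, w)} else {}))"
      by (intro SUP_cong) auto
    then show "parcs (split_vertex G x u w) = (\<Union>i\<in>pverts H. steps ((?s \<circ> P) i)) \<union>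
      (\<Union>(i, j)\<in>parcs H. steps (last ((?s \<circ> P) i) # (?s \<circ> Q) (i, j) @ [hd ((?s \<circ> P) j)]))"
      using x unfolding parcs_split_vertex arcs_W verts
      by (auto simp: steps_split_in_list split: if_splits)
  next
    fix i j y assume "i \<in> pverts H" "j \<in> pverts H" "y \<in> set ((?s \<circ> P) i)" "y \<in> set ((?s \<circ> P) j)"
    then show "i = j" using PP[of i j "?p y"] mem sub by simp
  next
    fix i e y assume "i \<in> pverts H" "e \<in> parcs H" "y \<in> set ((?s \<circ> P) i)" "y \<in> set ((?s \<circ> Q) e)"
    then show False using PQ[of i e "?p y"] mem sub subQ by simp
  next
    fix d e y assume "d \<in> parcs H" "e \<in> parcs H" "y \<in> set ((?s \<circ> Q) d)" "y \<in> set ((?s \<circ> Q) e)"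
    then show "d = e" using QQ[of d e "?p y"] mem subQ by simp
  next
    fix i assume "i \<in> pverts H"
    then show "distinct ((?s \<circ> P) i)"
      unfolding o_apply using distinct_P u sub by (intro distinct_split_in_list) blast+
  next
    fix e assume "e \<in> parcs H"
    then show "distinct ((?s \<circ> Q) e)"
      unfolding o_apply using distinct_Q u subQ by (intro distinct_split_in_list) blast+
  qed (use arc_verts P_nonempty in auto)
qed

section \<open>Splitting an arc that lies on a path\<close>

fun insert_between :: "'a \<Rightarrow> 'a \<Rightarrow> 'a \<Rightarrow> 'a list \<Rightarrow> 'a list" where
  "insert_between x y w [] = []"
| "insert_between x y w [a] = [a]"
| "insert_between x y w (a # b # zs) =
    (if (a, b) = (x, y) then [a, w] else [a]) @ insert_between x y w (b # zs)"

lemma insert_between_eq_Nil [simp]: "insert_between x y w xs = [] \<longleftrightarrow> xs = []"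
  by (induction xs rule: steps.induct) auto

lemma hd_insert_between [simp]: "hd (insert_between x y w xs) = hd xs"
  by (induction xs rule: steps.induct) auto

lemma last_insert_between [simp]: "last (insert_between x y w xs) = last xs"
  by (induction xs rule: steps.induct) auto

lemma set_insert_between:
  "set (insert_between x y w xs) = set xs \<union> (if (x, y) \<in> steps xs then {w} else {})"
  by (induction xs rule: steps.induct) auto

lemma distinct_insert_between:
  "\<lbrakk>distinct xs; w \<notin> set xs\<rbrakk> \<Longrightarrow> distinct (insert_between x y w xs)"
  by (induction xs rule: steps.induct) (auto simp: set_insert_between dest: steps_set)

lemma steps_insert_between:
  assumes "w \<noteq> x" "w \<noteq> y"
  shows "steps (insert_between x y w xs) =
    steps xs - {(x, y)} \<union> (if (x, y) \<in> steps xs then {(x, w), (w, y)} else {})"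
proof (induction xs rule: steps.induct)
  case (3 a b zs)
  have "steps (insert_between x y w (a # b # zs)) =
    (if (a, b) = (x, y) then {(x, w), (w, y)} else {(a, b)}) \<union> steps (insert_between x y w (b # zs))"
    by (auto simp: steps_Cons)
  then show ?case unfolding 3 using assms by auto
qed auto

text \<open>Insertion keeps the first and the last entry, so a new arc path can be recovered from
  its inner vertices.\<close>

lemma insert_between_ends:
  "insert_between x y w (a # zs @ [b]) =
    a # butlast (tl (insert_between x y w (a # zs @ [b]))) @ [b]"
proof -
  let ?l = "insert_between x y w (a # zs @ [b])"
  have "?l = a # tl ?l"
    using hd_insert_between[of x y w "a # zs @ [b]"]
    by (metis insert_between_eq_Nil list.distinct(1) list.exhaust_sel list.sel(1))
  moreover have "tl ?l \<noteq> []" by (cases zs) auto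
  moreover have "last (tl ?l) = b"
    using calculation last_insert_between[of x y w "a # zs @ [b]"]
    by (metis last.simps last_appendR last_snoc append_is_Nil_conv not_Cons_self2)
  ultimately show ?thesis by (metis append_butlast_last_id)
qed

context path_expansion
begin

lemma steps_PP: "\<lbrakk>i \<in> pverts H; k \<in> pverts H; (a, b) \<in> steps (P i); (a, b) \<in> steps (P k)\<rbrakk> \<Longrightarrow> i = k"
  using PP steps_set by metis

text \<open>A common arc would have to leave \<open>last (P i)\<close>, where \<open>P i\<close> has
  no further step. With \<open>steps_PP\<close> and \<open>steps_WW\<close> each arc of
  \<open>G\<close> lies on only one path, so the vertex that splits it enters only one list.\<close>

lemma steps_PW:
  assumes "i \<in> pverts H" "e \<in> parcs H" "(a, b) \<in> steps (P i)" "(a, b) \<in> steps (W e)"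
  shows False
proof -
  obtain k l where e: "e = (k, l)" by (cases e)
  have a: "a \<in> set (P i)" using steps_set assms(3) by metis
  from assms(2,4) e have "(k, l) \<in> parcs H" "(a, b) \<in> steps (W (k, l))" by auto
  then show False
  proof (cases rule: steps_W_cases)
    case start
    then have "k = i" using PP a assms arc_verts e last_P by metis
    then show False using last_not_steps distinct_P assms start by metis
  next
    case inner
    then show False using PQ a assms e by metis
  qed
qed

text \<open>An arc with an inner tail determines its path by \<open>QQ\<close>. An arc at the start
  determines the source by its tail and the target by its head, using
  \<open>start_unique\<close>.\<close>

lemma steps_WW:
  assumes "d \<in> parcs H" "e \<in> parcs H" "(a, b) \<in> steps (W d)" "(a, b) \<in> steps (W e)"
  shows "d = e"
proof -
  obtain i j k l where de: "d = (i, j)" "e = (k, l)" by (cases d, cases e)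
  have ij: "(i, j) \<in> parcs H" "(a, b) \<in> steps (W (i, j))"
    and kl: "(k, l) \<in> parcs H" "(a, b) \<in> steps (W (k, l))" using assms de by auto
  note V = arc_verts[OF ij(1)] arc_verts[OF kl(1)]
  from ij show ?thesis
  proof (cases rule: steps_W_cases)
    case start
    note s = start
    from kl show ?thesis
    proof (cases rule: steps_W_cases)
      case start
      then show ?thesis using s V last_P_eq start_unique[OF ij(1) kl(1)] de by metis
    next
      case inner
      then show ?thesis using s V PQ kl(1) last_P by metis
    qed
  next
    case inner
    note s = inner
    from kl show ?thesis
    proof (cases rule: steps_W_cases)
      case start
      then show ?thesis using s V PQ ij(1) last_P by metis
    next
      case inner
      then show ?thesis using s QQ assms de by metis
    qed
  qed
qed

end

text \<open>The split arc may touch an end of an arc path, so the insertion is made in the whole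
  path, ends included, and the ends are cut off afterwards.\<close>

lemma path_expansion_split_arc:
  assumes "path_expansion H P Q G" and xy: "(x, y) \<in> parcs G" and w: "w \<notin> pverts G"
  shows "path_expansion H (insert_between x y w \<circ> P)
    (\<lambda>e. butlast (tl (insert_between x y w (last (P (fst e)) # Q e @ [hd (P (snd e))]))))
    (split_arc G x y w)"
proof -
  interpret path_expansion H P Q G by fact
  let ?s = "insert_between x y w"
  define P' where "P' = ?s \<circ> P"
  define Q' where "Q' e = butlast (tl (?s (W e)))" for e
  have sub: "set (P i) \<subseteq> pverts G" if "i \<in> pverts H" for i using that by (auto simp: verts)
  have W_eq: "last (P' i) # Q' (i, j) @ [hd (P' j)] = ?s (W (i, j))" for i j
    unfolding P'_def Q'_def W_def using insert_between_ends[of x y w] by simp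
  from xy consider i where "i \<in> pverts H" "(x, y) \<in> steps (P i)"
    | e where "e \<in> parcs H" "(x, y) \<in> steps (W e)" unfolding arcs_W by blast
  then have "x \<in> pverts G \<and> y \<in> pverts G"
    by cases (use steps_set sub set_W in \<open>metis subsetD\<close>)+
  then have ne: "w \<noteq> x" "w \<noteq> y" using w by auto
  have dW: "distinct (?s (W e))" if "e \<in> parcs H" for e
    using that distinct_W set_W w by (intro distinct_insert_between) blast+
  have setQ: "set (Q' e) = set (Q e) \<union> (if (x, y) \<in> steps (W e) then {w} else {})"
    if "e \<in> parcs H" for e
  proof -
    obtain i j where e: "e = (i, j)" by (cases e)
    let ?a = "last (P i)" and ?b = "hd (P j)"
    have W': "?s (W e) = ?a # Q' e @ [?b]" using W_eq[of i j] by (simp add: e P'_def)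
    have d': "distinct (?a # Q' e @ [?b])" using dW[OF that] unfolding W' .
    have d: "distinct (?a # Q e @ [?b])" using distinct_W[OF that] by (simp add: e W_def)
    have ab: "?a \<noteq> w" "?b \<noteq> w" using set_W[OF that] w by (auto simp: W_def e)
    have "set (Q' e) = set (?s (W e)) - {?a, ?b}" unfolding W' using d' by auto
    also have "\<dots> = set (Q e) \<union> (if (x, y) \<in> steps (W e) then {w} else {})"
      unfolding set_insert_between using d ab by (auto simp: W_def e)
    finally show ?thesis .
  qed
  have setP: "set (P' i) = set (P i) \<union> (if (x, y) \<in> steps (P i) then {w} else {})" for i
    by (simp add: P'_def set_insert_between)
  have wP: "w \<notin> set (P i)" if "i \<in> pverts H" for i using w sub that by blast
  have wQ: "w \<notin> set (Q e)" if "e \<in> parcs H" for e using w that by (auto simp: verts)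
  have "path_expansion H P' Q' (split_arc G x y w)"
  proof
    have "(\<exists>i\<in>pverts H. (x, y) \<in> steps (P i)) \<or> (\<exists>e\<in>parcs H. (x, y) \<in> steps (W e))"
      using xy unfolding arcs_W by auto
    then show "pverts (split_arc G x y w) =
      (\<Union>i\<in>pverts H. set (P' i)) \<union> (\<Union>e\<in>parcs H. set (Q' e))"
      by (auto simp: split_arc_def verts setP setQ split: if_splits)
    have "(\<Union>(i, j)\<in>parcs H. steps (last (P' i) # Q' (i, j) @ [hd (P' j)])) =
      (\<Union>e\<in>parcs H. steps (?s (W e)))" by (auto simp: W_eq)
    then show "parcs (split_arc G x y w) = (\<Union>i\<in>pverts H. steps (P' i)) \<union>
      (\<Union>(i, j)\<in>parcs H. steps (last (P' i) # Q' (i, j) @ [hd (P' j)]))"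
      using xy by (auto simp: split_arc_def arcs_W P'_def steps_insert_between[OF ne] split: if_splits)
  next
    fix i j z assume "i \<in> pverts H" "j \<in> pverts H" "z \<in> set (P' i)" "z \<in> set (P' j)"
    then show "i = j" using PP[of i j] steps_PP[of i j] wP[of i] wP[of j]
      by (auto simp: setP split: if_splits)
  next
    fix i e z assume "i \<in> pverts H" "e \<in> parcs H" "z \<in> set (P' i)" "z \<in> set (Q' e)"
    then show False using PQ[of i e] steps_PW[of i e] wP[of i] wQ[of e]
      by (auto simp: setP setQ split: if_splits)
  next
    fix d e z assume "d \<in> parcs H" "e \<in> parcs H" "z \<in> set (Q' d)" "z \<in> set (Q' e)"
    then show "d = e" using QQ[of d e] steps_WW[of d e] wQ[of d] wQ[of e]
      by (auto simp: setQ split: if_splits)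
  next
    fix i assume "i \<in> pverts H"
    then show "distinct (P' i)" "P' i \<noteq> []"
      using distinct_P wP P_nonempty by (auto simp: P'_def intro!: distinct_insert_between)
  next
    fix e assume "e \<in> parcs H"
    then show "distinct (Q' e)" using dW[of e] by (simp add: Q'_def distinct_butlast distinct_tl)
  qed (use arc_verts in auto)
  then show ?thesis unfolding P'_def Q'_def W_def .
qed

section \<open>Weak double cycles as path expansions\<close>

lemma path_expansion_double_cycle:
  assumes "is_double_cycle m G"
  obtains h where "path_expansion (standard_double_cycle m) (\<lambda>i. [h i]) (\<lambda>_. []) G"
proof -
  let ?C = "standard_double_cycle m"
  from assms obtain h where m: "m \<ge> 3"
    and h: "pre_digraph.digraph_isomorphism (with_proj ?C) h"
    and G: "with_proj G = app_iso h (with_proj ?C)"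
    by (auto simp: is_double_cycle_def digraph_iso_def)
  interpret C: pair_digraph ?C by (rule pair_digraph_standard_double_cycle[OF m])
  have eqs: "pverts G = iso_verts h ` pverts ?C" "parcs G = iso_arcs h ` parcs ?C"
    "iso_tail h = fst" "iso_head h = snd"
    using arg_cong[OF G, of verts] arg_cong[OF G, of arcs] arg_cong[OF G, of tail]
      arg_cong[OF G, of head] by simp_all
  have inj: "inj_on (iso_verts h) (pverts ?C)"
    using h by (auto simp: pre_digraph.digraph_isomorphism_def)
  \<comment> \<open>Tail and head in \<open>with_proj G\<close> are the projections, so the arc part
    of the isomorphism is determined by its vertex part.\<close>
  have arc: "iso_arcs h a = (iso_verts h (fst a), iso_verts h (snd a))" if "a \<in> parcs ?C" for a
    using h that eqs by (auto simp: pre_digraph.digraph_isomorphism_def prod_eq_iff)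
  have "path_expansion ?C (\<lambda>i. [iso_verts h i]) (\<lambda>_. []) G"
  proof
    show "parcs G = (\<Union>i\<in>pverts ?C. steps [iso_verts h i]) \<union>
      (\<Union>(i, j)\<in>parcs ?C. steps (last [iso_verts h i] # [] @ [hd [iso_verts h j]]))"
      unfolding eqs(2) using arc by force
  qed (use C.in_arcsD1 C.in_arcsD2 inj eqs(1) in \<open>auto dest: inj_onD C.pair_no_loops\<close>)
  then show thesis by (rule that)
qed

text \<open>The underlying double cycle stays fixed under splittings; only the lists change.\<close>

lemma weak_double_cycle_path_expansion:
  assumes "weak_double_cycle G"
  shows "\<exists>m\<ge>3. \<exists>P Q. path_expansion (standard_double_cycle m) P Q G"
  using assms
proof induction
  case (double_cycle m G)
  then show ?case using path_expansion_double_cycle is_double_cycle_def by metis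
next
  case (split_vertex G x u w)
  then obtain m P Q where "m \<ge> 3" "path_expansion (standard_double_cycle m) P Q G" by blast
  with path_expansion_split_vertex[OF this(2) split_vertex.hyps(2-5)] show ?case by blast
next
  case (split_arc G x y w)
  then obtain m P Q where "m \<ge> 3" "path_expansion (standard_double_cycle m) P Q G" by blast
  with path_expansion_split_arc[OF this(2) split_arc.hyps(2,3)] show ?case by (intro exI conjI)
qed

section \<open>Skew-symmetries of double cycles\<close>

text \<open>The map \<open>\<rho>\<close> wraps the integers around the cycle and turns arithmetic
  modulo \<open>m\<close> into divisibility. A lift of \<open>f\<close> moves by 1 or -1 modulo
  \<open>m\<close> at each step, and injectivity forbids a change of direction, so \<open>f\<close>
  is a rotation or a reflection.\<close>

lemma skew_symmetry_cyclic_shift: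
  fixes \<rho> :: "int \<Rightarrow> 'b" and m :: int
  assumes m: "m \<ge> 3" and verts: "pverts H = range \<rho>"
    and \<rho>: "\<And>k l. \<rho> k = \<rho> l \<longleftrightarrow> m dvd k - l"
    and arcs: "parcs H = range (\<lambda>k. (\<rho> k, \<rho> (k + 1))) \<union> range (\<lambda>k. (\<rho> (k + 1), \<rho> k))"
    and f: "skew_symmetry H f" "unit_free H f"
  obtains c where "\<And>k. f (\<rho> k) = \<rho> (k + c)" "m dvd 2 * c" "\<not> m dvd c"
proof -
  have ff: "f (f (\<rho> k)) = \<rho> k" and fixfree: "f (\<rho> k) \<noteq> \<rho> k" for k
    using f(1) verts by (auto simp: skew_symmetry_def)
  have "f ` range \<rho> = range \<rho>"
    using f(1) verts by (simp add: skew_symmetry_def bij_betw_def)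
  then have "\<exists>l. f (\<rho> k) = \<rho> l" for k by blast
  \<comment> \<open>An arbitrary lift of \<open>f\<close> to the integers; its values matter only
    modulo \<open>m\<close>.\<close>
  then obtain g where g: "\<And>k. f (\<rho> k) = \<rho> (g k)" by metis
  have inj: "m dvd k - l" if "m dvd g k - g l" for k l
  proof -
    have "f (\<rho> k) = f (\<rho> l)" using that g \<rho> by simp
    then have "\<rho> k = \<rho> l" using ff by metis
    then show ?thesis using \<rho> by simp
  qed
  \<comment> \<open>Here \<open>m \<ge> 3\<close> enters: the steps 1 and -1 differ modulo
    \<open>m\<close>, and so do \<open>k\<close> and \<open>k + 2\<close>.\<close>
  have not2: "\<not> m dvd 2" using m zdvd_not_zless by simp
  define up where "up k \<longleftrightarrow> m dvd g (k + 1) - g k - 1" for k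
  define dn where "dn k \<longleftrightarrow> m dvd g (k + 1) - g k + 1" for k
  have "up k \<or> dn k" for k
  proof -
    have "(\<rho> k, \<rho> (k + 1)) \<in> parcs H" unfolding arcs by blast
    then have "(f (\<rho> (k + 1)), f (\<rho> k)) \<in> parcs H" using f(1) by (simp add: skew_symmetry_def)
    then have "(\<rho> (g (k + 1)), \<rho> (g k)) \<in> parcs H" by (simp add: g)
    then consider l where "\<rho> (g (k + 1)) = \<rho> l" "\<rho> (g k) = \<rho> (l + 1)"
      | l where "\<rho> (g (k + 1)) = \<rho> (l + 1)" "\<rho> (g k) = \<rho> l"
      unfolding arcs by auto
    then show ?thesis
    proof cases
      case 1
      then have "m dvd (g (k + 1) - l) - (g k - (l + 1))" using \<rho> dvd_diff by blast
      then show ?thesis by (simp add: dn_def algebra_simps)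
    next
      case 2
      then have "m dvd (g (k + 1) - (l + 1)) - (g k - l)" using \<rho> dvd_diff by blast
      then show ?thesis by (simp add: up_def algebra_simps)
    qed
  qed
  moreover have "\<not> (up k \<and> dn k)" for k
  proof
    assume "up k \<and> dn k"
    then have "m dvd (g (k + 1) - g k + 1) - (g (k + 1) - g k - 1)"
      unfolding up_def dn_def using dvd_diff by blast
    then show False using not2 by simp
  qed
  \<comment> \<open>A change of direction would give \<open>k\<close> and \<open>k + 2\<close> the
    same image.\<close>
  moreover have "\<not> (up k \<and> dn (k + 1))" "\<not> (dn k \<and> up (k + 1))" for k
  proof -
    have no: "\<not> m dvd g (k + 2) - g k" using inj[of "k + 2" k] not2 by auto
    show "\<not> (up k \<and> dn (k + 1))"
    proof
      assume "up k \<and> dn (k + 1)"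
      then have "m dvd (g (k + 1) - g k - 1) + (g (k + 1 + 1) - g (k + 1) + 1)"
        unfolding up_def dn_def using dvd_add by blast
      then show False using no by (simp add: algebra_simps)
    qed
    show "\<not> (dn k \<and> up (k + 1))"
    proof
      assume "dn k \<and> up (k + 1)"
      then have "m dvd (g (k + 1) - g k + 1) + (g (k + 1 + 1) - g (k + 1) - 1)"
        unfolding up_def dn_def using dvd_add by blast
      then show False using no by (simp add: algebra_simps)
    qed
  qed
  ultimately have step: "up (k + 1) \<longleftrightarrow> up k" and dn: "dn k \<longleftrightarrow> \<not> up k" for k by blast+
  have const: "up k \<longleftrightarrow> up 0" for k
  proof (induction k rule: int_induct[where k = 0])
    case (step1 i) then show ?case using step by blast
  next
    case (step2 i) then show ?case using step[of "i - 1"] by simp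
  qed simp
  show thesis
  proof (cases "up 0")
    case True
    then have up: "m dvd g (k + 1) - g k - 1" for k using const up_def by blast
    have shift: "m dvd g k - (k + g 0)" for k
    proof (induction k rule: int_induct[where k = 0])
      case (step1 i)
      have "m dvd (g (i + 1) - g i - 1) + (g i - (i + g 0))" using up step1 dvd_add by blast
      then show ?case by (simp add: algebra_simps)
    next
      case (step2 i)
      have "m dvd (g i - (i + g 0)) - (g (i - 1 + 1) - g (i - 1) - 1)" using up step2 dvd_diff by blast
      then show ?case by (simp add: algebra_simps)
    qed simp
    have fs: "f (\<rho> k) = \<rho> (k + g 0)" for k using g \<rho> shift by simp
    have "\<rho> (2 * g 0) = \<rho> 0" "\<rho> (g 0) \<noteq> \<rho> 0" using ff[of 0] fixfree[of 0] by (simp_all add: fs)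
    then have "m dvd 2 * g 0" "\<not> m dvd g 0" by (simp_all add: \<rho>)
    then show thesis using fs that by blast
  next
    case False
    then have down: "m dvd g (k + 1) - g k + 1" for k using const dn dn_def by blast
    have refl: "m dvd g k - (g 0 - k)" for k
    proof (induction k rule: int_induct[where k = 0])
      case (step1 i)
      have "m dvd (g (i + 1) - g i + 1) + (g i - (g 0 - i))" using down step1 dvd_add by blast
      then show ?case by (simp add: algebra_simps)
    next
      case (step2 i)
      have "m dvd (g i - (g 0 - i)) - (g (i - 1 + 1) - g (i - 1) + 1)" using down step2 dvd_diff by blast
      then show ?case by (simp add: algebra_simps)
    qed simp
    have fs: "f (\<rho> k) = \<rho> (g 0 - k)" for k using g \<rho> refl by simp
    show thesis
    \<comment> \<open>The reflection sends \<open>k\<close> to \<open>g 0 - k\<close>. Its centre is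
      a fixed vertex if \<open>g 0\<close> is even; if \<open>g 0\<close> is odd, it exchanges two
      neighbours and so has a unit arc.\<close>
    proof (cases "even (g 0)")
      case True
      then obtain b where "g 0 = 2 * b" by (rule evenE)
      then have "f (\<rho> b) = \<rho> b" using fs[of b] by simp
      then show thesis using fixfree by blast
    next
      case False
      then obtain b where "g 0 = 2 * b + 1" by (rule oddE)
      then have "f (\<rho> b) = \<rho> (b + 1)" using fs[of b] by (simp add: algebra_simps)
      then have "(\<rho> b, f (\<rho> b)) \<in> parcs H" unfolding arcs by auto
      then show thesis using f(2) verts by (simp add: unit_free_def)
    qed
  qed
qed

text \<open>Both maps are rotations by an element of order two modulo \<open>m\<close>, and there is
  at most one: in \<open>2 * c = m * a\<close> and \<open>2 * d = m * b\<close> both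
  \<open>a\<close> and \<open>b\<close> are odd, so \<open>m\<close> divides
  \<open>c - d\<close>.\<close>

lemma cyclic_skew_symmetry_unique:
  fixes \<rho> :: "int \<Rightarrow> 'b" and m :: int
  assumes "m \<ge> 3" "pverts H = range \<rho>"
    and \<rho>: "\<And>k l. \<rho> k = \<rho> l \<longleftrightarrow> m dvd k - l"
    and "parcs H = range (\<lambda>k. (\<rho> k, \<rho> (k + 1))) \<union> range (\<lambda>k. (\<rho> (k + 1), \<rho> k))"
    and "skew_symmetry H f" "unit_free H f" "skew_symmetry H g" "unit_free H g"
  shows "\<forall>i\<in>pverts H. f i = g i"
proof -
  obtain c where c: "\<And>k. f (\<rho> k) = \<rho> (k + c)" "m dvd 2 * c" "\<not> m dvd c"
    using skew_symmetry_cyclic_shift[OF assms(1-4)] assms(5,6) by metis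
  obtain d where d: "\<And>k. g (\<rho> k) = \<rho> (k + d)" "m dvd 2 * d" "\<not> m dvd d"
    using skew_symmetry_cyclic_shift[OF assms(1-4)] assms(7,8) by metis
  obtain a b where ab: "2 * c = m * a" "2 * d = m * b" using c(2) d(2) by (auto elim!: dvdE)
  have "odd a" "odd b" using ab c(3) d(3) by (auto elim!: evenE)
  then have "even (a - b)" by simp
  then obtain e where "a - b = 2 * e" by (rule evenE)
  moreover have "2 * (c - d) = m * (a - b)" using ab by (simp add: algebra_simps)
  ultimately have "c - d = m * e" by simp
  then have "m dvd c - d" by simp
  then show ?thesis using assms(2) c(1) d(1) \<rho> by auto
qed

section \<open>Integer parametrisation of the standard double cycle\<close>

text \<open>The representative of \<open>k\<close> modulo \<open>m\<close> in \<open>{1..m}\<close>;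
  shifting by one before and after taking the remainder yields \<open>m\<close> in place of
  0.\<close>

definition cycle_vertex :: "nat \<Rightarrow> int \<Rightarrow> nat" where
  "cycle_vertex m k = nat ((k - 1) mod int m) + 1"

lemma
  assumes "m \<ge> 3"
  shows pverts_standard_double_cycle: "pverts (standard_double_cycle m) = range (cycle_vertex m)"
    and cycle_vertex_eq_iff: "cycle_vertex m k = cycle_vertex m l \<longleftrightarrow> int m dvd k - l"
    and parcs_standard_double_cycle: "parcs (standard_double_cycle m) =
      range (\<lambda>k. (cycle_vertex m k, cycle_vertex m (k + 1))) \<union>
      range (\<lambda>k. (cycle_vertex m (k + 1), cycle_vertex m k))"
proof -
  let ?\<rho> = "cycle_vertex m"
  have m: "int m > 0" using assms by simp
  show "?\<rho> k = ?\<rho> l \<longleftrightarrow> int m dvd k - l"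
    using m by (simp add: cycle_vertex_def eq_nat_nat_iff mod_eq_dvd_iff)
  have mem: "?\<rho> k \<in> {1..m}" for k
    using pos_mod_bound[OF m, of "k - 1"] m by (simp add: cycle_vertex_def nat_less_iff Suc_le_eq)
  have id: "?\<rho> (int i) = i" if "i \<in> {1..m}" for i
    using that by (simp add: cycle_vertex_def of_nat_diff nat_diff_distrib')
  have succ: "?\<rho> k mod m + 1 = ?\<rho> (k + 1)" for k
  proof -
    have "int (?\<rho> k mod m) = k mod int m"
      using m by (simp add: cycle_vertex_def zmod_int mod_simps)
    then show ?thesis by (simp add: cycle_vertex_def)
  qed
  have range: "{1..m} = range ?\<rho>"
  proof
    show "{1..m} \<subseteq> range ?\<rho>" using id by (metis rangeI subsetI)
  qed (use mem in auto)
  then show "pverts (standard_double_cycle m) = range ?\<rho>" by (simp add: standard_double_cycle_def)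
  show "parcs (standard_double_cycle m) =
      range (\<lambda>k. (?\<rho> k, ?\<rho> (k + 1))) \<union> range (\<lambda>k. (?\<rho> (k + 1), ?\<rho> k))"
    unfolding standard_double_cycle_def range succ[symmetric] by auto
qed

text \<open>The neighbours with indices \<open>k + 1\<close> and \<open>k - 1\<close> are different,
  since \<open>m\<close> does not divide 2, and each is joined to the vertex with index
  \<open>k\<close> by arcs in both directions.\<close>

lemma branch_standard_double_cycle:
  assumes "m \<ge> 3"
  shows "out_branch (standard_double_cycle m) = pverts (standard_double_cycle m)"
    and "in_branch (standard_double_cycle m) = pverts (standard_double_cycle m)"
proof -
  let ?C = "standard_double_cycle m" and ?\<rho> = "cycle_vertex m"
  interpret pair_digraph ?C by (rule pair_digraph_standard_double_cycle[OF assms])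
  have ne: "?\<rho> (k + 1) \<noteq> ?\<rho> (k - 1)" for k
    using assms zdvd_not_zless[of 2 "int m"] by (simp add: cycle_vertex_eq_iff)
  have nbr: "(?\<rho> k, ?\<rho> (k + 1)) \<in> parcs ?C" "(?\<rho> (k + 1), ?\<rho> k) \<in> parcs ?C" for k
    unfolding parcs_standard_double_cycle[OF assms] by blast+
  have "?\<rho> k \<in> out_branch ?C" "?\<rho> k \<in> in_branch ?C" for k
    unfolding out_branch_def in_branch_def using ne[of k] nbr[of k] nbr[of "k - 1"] by auto
  moreover have "out_branch ?C \<subseteq> pverts ?C" "in_branch ?C \<subseteq> pverts ?C"
    unfolding out_branch_def in_branch_def using in_arcsD1 in_arcsD2 by blast+
  ultimately show "out_branch ?C = pverts ?C" "in_branch ?C = pverts ?C"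
    unfolding pverts_standard_double_cycle[OF assms] by blast+
qed

theorem theorem7p7:
  fixes G :: "'a pair_pre_digraph" and \<sigma> \<tau> :: "'a \<Rightarrow> 'a"
  assumes "weak_double_cycle G"
    and "skew_symmetry G \<sigma>" and "unit_free G \<sigma>"
    and "skew_symmetry G \<tau>" and "unit_free G \<tau>"
  shows "\<forall>v \<in> pverts G. \<sigma> v = \<tau> v"
proof -
  obtain m P Q where m: "m \<ge> 3" and P: "path_expansion (standard_double_cycle m) P Q G"
    using weak_double_cycle_path_expansion[OF assms(1)] by blast
  have "int m \<ge> 3" using m by simp
  note unique = cyclic_skew_symmetry_unique[OF this pverts_standard_double_cycle[OF m]
      cycle_vertex_eq_iff[OF m] parcs_standard_double_cycle[OF m]]
  show ?thesis
    using path_expansion_unique[OF P weak_double_cycle_pair_digraph[OF assms(1)]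
        branch_standard_double_cycle[OF m] unique assms(2-5)] .
qed

end
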